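(* Let $C_0>0$ and $\gamma_0>0$. Consider any family of nested Galerkin problems (each with at least one nonzero trial space $X_\ell$) whose continuity constants $C_a$ and discrete inf-sup constants $\gamma$ satisfy $C_a\le C_0$ and $\gamma\ge\gamma_0$. Set $$K_0=\frac{C_0}{\gamma_0},\qquad \sigma_0=\log_2\Bigl(1+\sqrt{1-K_0^{-2}}\Bigr)<1,\qquad C_{\mathrm{qo}}(K_0)=4K_0^2\Bigl(1+\sqrt{1-K_0^{-2}}\Bigr).$$ Then every problem in the family, for every target $u\in X$, with $u_\ell:=G_\ell u$, satisfies $$\sum_{k=\ell}^{\ell+N-1}\|u_{k+1}-u_k\|_X^2\le C_{\mathrm{qo}}(K_0)\,N^{\sigma_0}\,\|u-u_\ell\|_X^2$$ for all $\ell\ge0$ and $N\ge1$.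
   Context: A nested Galerkin problem consists of real Hilbert spaces $X,Y$, a bilinear form $a:X\times Y\to\mathbb{R}$ with $|a(x,y)|\le C_a\|x\|_X\|y\|_Y$ for all $x,y$ (continuity constant $C_a$), whose continuous variational problem is well posed in the Babuška–Nečas sense (for every bounded linear functional $F$ on $Y$ there is a unique $x\in X$ with $a(x,\cdot)=F$, depending continuously on $F$), and nested finite-dimensional subspaces $X_0\subset X_1\subset\cdots\subset X$, $Y_0\subset Y_1\subset\cdots\subset Y$ with $\dim X_\ell=\dim Y_\ell$, satisfying the uniform discrete inf-sup condition with constant $\gamma>0$: $$\inf_{0\ne x_\ell\in X_\ell}\ \sup_{0\ne y_\ell\in Y_\ell}\frac{|a(x_\ell,y_\ell)|}{\|x_\ell\|_X\|y_\ell\|_Y}\ge\gamma\qquad(\ell\ge0).$$ The Galerkin projection $G_\ell:X\to X_\ell$ is defined by $a(G_\ell x,y_\ell)=a(x,y_\ell)$ for all $y_\ell\in Y_\ell$ (it exists and is unique). The spaces, forms and subspaces may vary over the family. *)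

theory Defs
  imports "HOL-Analysis.Analysis"
begin

definition well_posed ::
    "('x::{real_inner,complete_space} \<Rightarrow> 'y::{real_inner,complete_space} \<Rightarrow> real) \<Rightarrow> bool" where
  "well_posed a \<longleftrightarrow>
     (\<forall>F :: 'y \<Rightarrow>\<^sub>L real. \<exists>!x. \<forall>y. a x y = blinfun_apply F y) \<and>
     continuous_on UNIV (\<lambda>F :: 'y \<Rightarrow>\<^sub>L real. THE x. \<forall>y. a x y = blinfun_apply F y)"

text \<open>
  The infimum and supremum are taken in the extended reals, so that the condition is vacuous
  for the zero trial space (infimum over the empty set is infinity).
\<close>

definition inf_sup :: "('x::real_normed_vector \<Rightarrow> 'y::real_normed_vector \<Rightarrow> real)
    \<Rightarrow> 'x set \<Rightarrow> 'y set \<Rightarrow> ereal" where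
  "inf_sup a U V =
     (INF x \<in> U - {0}. SUP y \<in> V - {0}. ereal (\<bar>a x y\<bar> / (norm x * norm y)))"

locale nested_galerkin =
  fixes a :: "'x::{real_inner,complete_space} \<Rightarrow> 'y::{real_inner,complete_space} \<Rightarrow> real"
    and X :: "nat \<Rightarrow> 'x set" and Y :: "nat \<Rightarrow> 'y set"
    and C\<^sub>a \<gamma> :: real
  assumes bilinear: "bilinear a"
    and continuity: "\<bar>a x y\<bar> \<le> C\<^sub>a * norm x * norm y"
    and well_posed: "well_posed a"
    and subspace_X: "subspace (X l)"
    and subspace_Y: "subspace (Y l)"
    and finite_dim_X: "\<exists>B. finite B \<and> X l = span B"
    and finite_dim_Y: "\<exists>B. finite B \<and> Y l = span B"
    and nested_X: "X l \<subseteq> X (Suc l)"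
    and nested_Y: "Y l \<subseteq> Y (Suc l)"
    and dim_eq: "dim (X l) = dim (Y l)"
    and gamma_pos: "\<gamma> > 0"
    and discrete_inf_sup: "inf_sup a (X l) (Y l) \<ge> ereal \<gamma>"

definition galerkin_proj :: "('x \<Rightarrow> 'y \<Rightarrow> real) \<Rightarrow> 'x set \<Rightarrow> 'y set \<Rightarrow> 'x \<Rightarrow> 'x" where
  "galerkin_proj a U V x = (THE z. z \<in> U \<and> (\<forall>y\<in>V. a z y = a x y))"

definition sigma_qo :: "real \<Rightarrow> real" where
  "sigma_qo K = log 2 (1 + sqrt (1 - K powi (-2)))"

definition C_qo :: "real \<Rightarrow> real" where
  "C_qo K = 4 * K\<^sup>2 * (1 + sqrt (1 - K powi (-2)))"

end

theory Submission
  imports Defs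
begin

text \<open>
  The Galerkin projections \<open>G\<^sub>k\<close> are uniformly bounded, \<open>\<parallel>G\<^sub>k\<parallel> \<le> K = C\<^sub>0/\<gamma>\<^sub>0\<close>, and, since the trial and
  the test spaces are both nested, they satisfy \<open>G\<^sub>j G\<^sub>k = G\<^bsub>min j k\<^esub>\<close>. The
  estimate is a property of chains of finite-rank oblique projections of this kind (theorem
  \<open>projection_chain_square_sum\<close>).

  Write \<open>d\<^sub>k = (G\<^bsub>k+1\<^esub> - G\<^sub>k) v\<close> with \<open>v = u - G\<^sub>l u\<close>, so that \<open>d\<^sub>k\<close> is the increment of the
  Galerkin solutions for \<open>k \<ge> l\<close>. The sum \<open>S = \<Sum>\<parallel>d\<^sub>k\<parallel>\<^sup>2\<close> equals \<open>\<langle>v, \<Sum>z\<^sub>k\<rangle>\<close>, where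
  \<open>z\<^sub>k\<close> is the adjoint of \<open>G\<^bsub>k+1\<^esub> - G\<^sub>k\<close> applied to \<open>d\<^sub>k\<close>. Passing to the adjoints is what gives
  the exponent \<open>\<sigma>\<^sub>0 < 1\<close>: an upper bound for the norm of a sum is needed, and halving the sum
  costs only a factor \<open>1 + q\<close> with \<open>q = sqrt (1 - 1/K\<^sup>2)\<close>, because the two halves
  lie in the range and the kernel of one adjoint projection of norm at most \<open>K\<close>, and \<open>q\<close> bounds
  the cosine of the angle between these spaces (lemmas \<open>cosine_le_of_norm_le\<close> and
  \<open>cosine_range_kernel_adjoint\<close>). With \<open>N \<le> 2\<^sup>m\<close> terms, halving \<open>m\<close> times gives
  \<open>\<parallel>\<Sum>z\<^sub>k\<parallel>\<^sup>2 \<le> (1 + q)\<^sup>m \<Sum>\<parallel>z\<^sub>k\<parallel>\<^sup>2\<close> (lemma \<open>norm_sum_le_by_halving\<close>). Since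
  \<open>\<parallel>z\<^sub>k\<parallel> \<le> 2 K \<parallel>d\<^sub>k\<parallel>\<close>, Cauchy-Schwarz for \<open>S = \<langle>v, \<Sum>z\<^sub>k\<rangle>\<close> yields
  \<open>S \<le> 4 K\<^sup>2 (1 + q)\<^sup>m \<parallel>v\<parallel>\<^sup>2\<close>, and the least such \<open>m\<close> has \<open>2\<^sup>m \<le> 2 N\<close>, whence
  \<open>(1 + q)\<^sup>m \<le> (1 + q) N powr \<sigma>\<^sub>0\<close>.

  The adjoints are taken on the finite-dimensional span of \<open>v\<close> and the largest trial space
  involved, where they come from an orthogonal basis. The same representation, now on the test space,
  turns the discrete equations into the inversion of an injective linear map between spaces of equal
  dimension, which gives the existence of \<open>G\<^sub>k\<close>.
\<close>

section \<open>Representation of linear functionals and equal dimensions\<close>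

lemma span_orthogonal_represents:
  fixes C :: "'a::real_inner set"
  assumes "finite C" "pairwise orthogonal C" "linear f" "y \<in> span C"
  shows "(\<Sum>c\<in>C. (f c / (c \<bullet> c)) *\<^sub>R c) \<bullet> y = f y"
proof -
  let ?z = "\<Sum>c\<in>C. (f c / (c \<bullet> c)) *\<^sub>R c"
  have "?z \<bullet> b = f b" if b: "b \<in> C" for b
  proof -
    have "?z \<bullet> b = (\<Sum>c\<in>C. (f c / (c \<bullet> c)) * (c \<bullet> b))"
      by (simp add: inner_sum_left)
    also have "\<dots> = (\<Sum>c\<in>C. if c = b then (f b / (b \<bullet> b)) * (b \<bullet> b) else 0)"
      using assms(2) b by (intro sum.cong) (auto simp: pairwise_def orthogonal_def)
    also have "\<dots> = (f b / (b \<bullet> b)) * (b \<bullet> b)"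
      using assms(1) b by simp
    also have "\<dots> = f b"
      using linear_0[OF assms(3)] by auto
    finally show ?thesis .
  qed
  moreover have "linear (\<lambda>y. ?z \<bullet> y)"
    by (intro linearI) (auto simp: inner_add_right)
  ultimately show ?thesis
    using linear_eq_on[OF _ assms(3,4)] by blast
qed

lemma Riesz_representation_span:
  fixes B :: "'a::real_inner set"
  assumes "finite B" "linear f"
  obtains z where "z \<in> span B" "\<And>y. y \<in> span B \<Longrightarrow> z \<bullet> y = f y"
proof -
  obtain C where C: "finite C" "span C = span B" "pairwise orthogonal C"
    using basis_orthogonal[OF assms(1)] by blast
  have "(\<Sum>c\<in>C. (f c / (c \<bullet> c)) *\<^sub>R c) \<in> span B"
    unfolding C(2)[symmetric] by (intro span_sum span_scale span_base)
  with span_orthogonal_represents[OF C(1,3) assms(2)] C(2) show ?thesis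
    using that by blast
qed

text \<open>
  The image of a basis of \<open>U\<close> is independent and has as many elements as a basis of \<open>W\<close>, so no
  vector of \<open>W\<close> can be added to it. The ambient spaces may be infinite-dimensional.
\<close>

lemma linear_inj_on_equal_dim_surj:
  fixes R :: "'a::real_vector \<Rightarrow> 'b::real_vector"
  assumes R: "linear R" "inj_on R U" "R ` U \<subseteq> W"
    and U: "subspace U" and W: "W = span T" "finite T" and dim: "dim U = dim W"
  shows "W \<subseteq> R ` U"
proof -
  obtain B where B: "B \<subseteq> U" "independent B" "U \<subseteq> span B" "card B = dim U"
    by (rule basis_exists)
  obtain T' where T': "T' \<subseteq> W" "independent T'" "W \<subseteq> span T'" "card T' = dim W"
    by (rule basis_exists)
  have span_B: "span B = U"
    using B(1,3) U by (simp add: span_minimal subset_antisym)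
  have ind: "independent (R ` B)"
    using linear_independent_injective_image[OF R(1) B(2)] R(2) span_B by simp
  have "finite T'"
    using independent_span_bound[OF W(2) T'(2)] T'(1) W(1) by auto
  note bound = independent_span_bound[OF this]
  have card: "card (R ` B) = card T'"
    using B(1,4) R(2) T'(4) dim card_image inj_on_subset by metis
  have "W \<subseteq> span (R ` B)"
  proof
    fix w assume w: "w \<in> W"
    show "w \<in> span (R ` B)"
    proof (rule ccontr)
      assume n: "w \<notin> span (R ` B)"
      then have "independent (insert w (R ` B))"
        using ind by (simp add: independent_insert)
      moreover have "insert w (R ` B) \<subseteq> span T'"
        using w T'(3) R(3) B(1) by blast
      ultimately have "finite (insert w (R ` B)) \<and> card (insert w (R ` B)) \<le> card T'"
        by (rule bound)
      moreover have "w \<notin> R ` B"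
        using n span_base[of w "R ` B"] by metis
      ultimately show False
        using card by (auto simp: card_insert_disjoint)
    qed
  qed
  also have "\<dots> = R ` U"
    using linear_span_image[OF R(1), of B] span_B by simp
  finally show ?thesis .
qed

section \<open>Angles and sums of almost orthogonal vectors\<close>

text \<open>
  The distance from \<open>p\<close> to the line spanned by \<open>r\<close> is \<open>\<parallel>p\<parallel>\<close> times the sine of the angle between
  \<open>p\<close> and \<open>r\<close>, and the hypothesis makes it at least \<open>\<parallel>p\<parallel>/K\<close>. So the sine is at least \<open>1/K\<close>.
\<close>

lemma cosine_le_of_norm_le:
  fixes p r :: "'a::real_inner"
  assumes K: "K \<ge> 1" and le: "\<And>t. norm p \<le> K * norm (p + t *\<^sub>R r)"
  shows "\<bar>p \<bullet> r\<bar> \<le> sqrt (1 - 1 / K\<^sup>2) * norm p * norm r"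
proof (cases "r = 0")
  case False
  then have r: "r \<bullet> r > 0" by simp
  \<comment> \<open>The foot of the perpendicular from \<open>p\<close> to the line through \<open>r\<close>.\<close>
  define t where "t = - (p \<bullet> r) / (r \<bullet> r)"
  have "(norm (p + t *\<^sub>R r))\<^sup>2 = p \<bullet> p + 2 * t * (p \<bullet> r) + t\<^sup>2 * (r \<bullet> r)"
    unfolding power2_norm_eq_inner
    by (simp add: inner_add_left inner_add_right inner_commute power2_eq_square algebra_simps)
  also have "\<dots> = p \<bullet> p - (p \<bullet> r)\<^sup>2 / (r \<bullet> r)"
    using r by (simp add: t_def field_simps power2_eq_square)
  finally have dist: "(norm (p + t *\<^sub>R r))\<^sup>2 = p \<bullet> p - (p \<bullet> r)\<^sup>2 / (r \<bullet> r)" .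
  have "(norm p)\<^sup>2 \<le> (K * norm (p + t *\<^sub>R r))\<^sup>2"
    using le by (intro power_mono) auto
  then have "p \<bullet> p \<le> K\<^sup>2 * (p \<bullet> p - (p \<bullet> r)\<^sup>2 / (r \<bullet> r))"
    unfolding power_mult_distrib dist by (simp add: power2_norm_eq_inner)
  then have "(p \<bullet> p) / K\<^sup>2 \<le> p \<bullet> p - (p \<bullet> r)\<^sup>2 / (r \<bullet> r)"
    using K by (simp add: pos_divide_le_eq mult.commute)
  then have "(p \<bullet> r)\<^sup>2 / (r \<bullet> r) \<le> (1 - 1 / K\<^sup>2) * (p \<bullet> p)"
    by (simp add: algebra_simps)
  then have "(p \<bullet> r)\<^sup>2 \<le> (1 - 1 / K\<^sup>2) * (p \<bullet> p) * (r \<bullet> r)"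
    using r by (simp add: pos_divide_le_eq)
  then have "sqrt ((p \<bullet> r)\<^sup>2) \<le> sqrt ((1 - 1 / K\<^sup>2) * (p \<bullet> p) * (r \<bullet> r))"
    by (rule real_sqrt_le_mono)
  then show ?thesis
    by (simp add: real_sqrt_mult norm_eq_sqrt_inner)
qed simp

text \<open>
  If \<open>Q\<close> has an adjoint that fixes \<open>p\<close> and sends \<open>r\<close> to zero, then \<open>p\<close> and \<open>r\<close> satisfy the two
  equations. Testing \<open>p + t r\<close> with \<open>Q p\<close> removes \<open>r\<close>, which bounds \<open>p\<close> by \<open>p + t r\<close>.
\<close>

lemma cosine_range_kernel_adjoint:
  fixes p r :: "'a::real_inner"
  assumes K: "K \<ge> 1" and bound: "norm (Q p) \<le> K * norm p"
    and p: "p \<bullet> Q p = p \<bullet> p" and r: "r \<bullet> Q p = 0"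
  shows "\<bar>p \<bullet> r\<bar> \<le> sqrt (1 - 1 / K\<^sup>2) * norm p * norm r"
proof (rule cosine_le_of_norm_le[OF K])
  fix t
  have "norm p * norm p = (p + t *\<^sub>R r) \<bullet> Q p"
    using p r by (simp add: inner_add_left norm_eq_sqrt_inner)
  also have "\<dots> \<le> norm (p + t *\<^sub>R r) * norm (Q p)"
    by (rule norm_cauchy_schwarz)
  also have "\<dots> \<le> norm (p + t *\<^sub>R r) * (K * norm p)"
    by (intro mult_left_mono bound) simp
  finally have "norm p * norm p \<le> (K * norm (p + t *\<^sub>R r)) * norm p"
    by (simp add: mult_ac)
  then show "norm p \<le> K * norm (p + t *\<^sub>R r)"
    using K by (cases "p = 0") auto
qed

text \<open>
  Cutting the sum at its middle turns one squared norm into two and costs the factor \<open>1 + q\<close>, since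
  \<open>\<parallel>p + r\<parallel>\<^sup>2 \<le> (1 + q) (\<parallel>p\<parallel>\<^sup>2 + \<parallel>r\<parallel>\<^sup>2)\<close>; after \<open>m\<close> cuts only single terms are left.
\<close>

lemma norm_sum_le_by_halving:
  fixes z :: "nat \<Rightarrow> 'a::real_inner"
  assumes q: "q \<ge> 0"
    and angle: "\<And>i m j. s \<le> i \<Longrightarrow> i \<le> m \<Longrightarrow> m \<le> j \<Longrightarrow> j \<le> e \<Longrightarrow>
      \<bar>sum z {i..<m} \<bullet> sum z {m..<j}\<bar> \<le> q * norm (sum z {i..<m}) * norm (sum z {m..<j})"
  shows "s \<le> i \<Longrightarrow> i + n \<le> e \<Longrightarrow> n \<le> 2 ^ m \<Longrightarrow>
    (norm (sum z {i..<i + n}))\<^sup>2 \<le> (1 + q) ^ m * (\<Sum>k = i..<i + n. (norm (z k))\<^sup>2)"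
proof (induction m arbitrary: i n)
  case 0
  then have "n = 0 \<or> n = 1" by auto
  then show ?case by auto
next
  case (Suc m)
  \<comment> \<open>When \<open>n \<le> 2 ^ m\<close>, the second part is empty.\<close>
  define h where "h = min n (2 ^ m)"
  define h' where "h' = n - h"
  have n: "n = h + h'" and h: "h \<le> 2 ^ m" "h' \<le> 2 ^ m"
    using Suc.prems(3) by (auto simp: h_def h'_def)
  define p where "p = sum z {i..<i + h}"
  define r where "r = sum z {i + h..<i + h + h'}"
  define S where "S = (\<lambda>a b. \<Sum>k = a..<b. (norm (z k))\<^sup>2)"
  have "(norm p)\<^sup>2 \<le> (1 + q) ^ m * S i (i + h)"
    unfolding p_def S_def using Suc.prems n h by (intro Suc.IH) auto
  moreover have "(norm r)\<^sup>2 \<le> (1 + q) ^ m * S (i + h) (i + h + h')"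
    unfolding r_def S_def using Suc.prems n h by (intro Suc.IH) auto
  moreover have "S i (i + h) + S (i + h) (i + h + h') = S i (i + n)"
    unfolding S_def n by (simp add: sum.atLeastLessThan_concat add.assoc)
  ultimately have parts: "(norm p)\<^sup>2 + (norm r)\<^sup>2 \<le> (1 + q) ^ m * S i (i + n)"
    by (metis add_mono distrib_left)
  have "\<bar>p \<bullet> r\<bar> \<le> q * norm p * norm r"
    unfolding p_def r_def using Suc.prems n by (intro angle) auto
  moreover have "2 * (q * norm p * norm r) \<le> q * ((norm p)\<^sup>2 + (norm r)\<^sup>2)"
    using mult_left_mono[OF sum_squares_bound[of "norm p" "norm r"] q] by (simp add: mult_ac)
  moreover have "(norm (p + r))\<^sup>2 = (norm p)\<^sup>2 + (norm r)\<^sup>2 + 2 * (p \<bullet> r)"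
    by (simp add: power2_norm_eq_inner inner_add_left inner_add_right inner_commute)
  ultimately have "(norm (p + r))\<^sup>2 \<le> (1 + q) * ((norm p)\<^sup>2 + (norm r)\<^sup>2)"
    by (simp add: algebra_simps)
  also have "\<dots> \<le> (1 + q) * ((1 + q) ^ m * S i (i + n))"
    using parts q by (intro mult_left_mono) auto
  finally have "(norm (p + r))\<^sup>2 \<le> (1 + q) ^ Suc m * S i (i + n)"
    by (simp add: mult_ac)
  moreover have "p + r = sum z {i..<i + n}"
    unfolding p_def r_def n by (simp add: sum.atLeastLessThan_concat add.assoc)
  ultimately show ?case
    by (simp add: S_def)
qed

section \<open>Chains of uniformly bounded projections\<close>

text \<open>
  The sum of squares is \<open>\<langle>v, \<Sum>z\<^sub>k\<rangle>\<close> with \<open>z\<^sub>k\<close> the adjoint of \<open>P\<^bsub>k+1\<^esub> - P\<^sub>k\<close> applied to the increment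
  of \<open>v\<close>. The halving argument for the \<open>z\<^sub>k\<close> loses \<open>1 + q\<close> per doubling. Halving
  \<open>v = P\<^sub>k v + (v - P\<^sub>k v)\<close> directly would instead need a lower bound for the norm of a sum and lose
  \<open>1 / (1 - q) = K\<^sup>2 (1 + q)\<close> per doubling.
\<close>

theorem projection_chain_square_sum:
  fixes P :: "nat \<Rightarrow> 'a::real_inner \<Rightarrow> 'a"
  assumes lin: "\<And>k. linear (P k)"
    and comp: "\<And>j k x. P j (P k x) = P (min j k) x"
    and bound: "\<And>k x. norm (P k x) \<le> K * norm x"
    and rank: "\<And>k. \<exists>B. finite B \<and> range (P k) \<subseteq> span B"
    and K: "K \<ge> 1" and N: "N \<le> 2 ^ m"
  shows "(\<Sum>k = l..<l + N. (norm (P (Suc k) v - P k v))\<^sup>2)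
    \<le> 4 * K\<^sup>2 * (1 + sqrt (1 - 1 / K\<^sup>2)) ^ m * (norm v)\<^sup>2"
proof -
  define q where "q = sqrt (1 - 1 / K\<^sup>2)"
  define D where "D = (\<lambda>k x. P (Suc k) x - P k x)"
  obtain B where B: "finite B" "range (P (l + N)) \<subseteq> span B"
    using rank by blast
  define V where "V = span (insert v B)"
  have q: "q \<ge> 0"
    using K by (simp add: q_def power_le_one divide_le_eq_1)
  have P_V: "P k x \<in> V" if "k \<le> l + N" for k x
  proof -
    have "P k x = P (l + N) (P k x)"
      using that by (simp add: comp min_absorb2)
    then have "P k x \<in> span B"
      using B(2) by (metis rangeI subsetD)
    then show ?thesis
      unfolding V_def using span_mono[of B "insert v B"] by blast
  qed
  have lin_D: "linear (D k)" for k
    unfolding D_def by (intro linear_compose_sub lin)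
  have bound_D: "norm (D k x) \<le> 2 * K * norm x" for k x
    using norm_triangle_ineq4[of "P (Suc k) x" "P k x"] bound[of "Suc k" x] bound[of k x]
    by (simp add: D_def)
  have D_P: "D k (P j x) = (if k < j then D k x else 0)" for j k x
    by (auto simp: D_def comp min_def not_less_eq_eq le_Suc_eq)

  \<comment> \<open>\<open>V\<close> is invariant under the projections, so the adjoints on \<open>V\<close> suffice.\<close>
  have "\<exists>z\<in>V. \<forall>x\<in>V. z \<bullet> x = D k x \<bullet> D k v" for k
  proof -
    have "linear (\<lambda>x. D k x \<bullet> D k v)"
      by (intro linearI) (simp_all add: linear_add[OF lin_D] linear_scale[OF lin_D] inner_add_left)
    then obtain z where "z \<in> V" "\<And>x. x \<in> V \<Longrightarrow> z \<bullet> x = D k x \<bullet> D k v"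
      unfolding V_def using Riesz_representation_span[of "insert v B"] B(1) by blast
    then show ?thesis by blast
  qed
  then obtain z where z_V: "z k \<in> V" and z: "\<And>x. x \<in> V \<Longrightarrow> z k \<bullet> x = D k x \<bullet> D k v" for k
    by metis

  have z_P: "z k \<bullet> P j x = (if k < j then z k \<bullet> x else 0)"
    if "j \<le> l + N" "x \<in> V" for j k x
    using that by (simp add: z P_V D_P)
  \<comment> \<open>The terms before \<open>j\<close> are fixed by the adjoint of \<open>P j\<close> and the later ones are killed by it.\<close>
  have angle: "\<bar>sum z {i..<j} \<bullet> sum z {j..<e}\<bar> \<le> q * norm (sum z {i..<j}) * norm (sum z {j..<e})"
    if "j \<le> l + N" for i j e
    unfolding q_def
  proof (rule cosine_range_kernel_adjoint[OF K bound])
    have V: "sum z {i..<j} \<in> V"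
      unfolding V_def by (intro span_sum) (use z_V in \<open>simp add: V_def\<close>)
    show "sum z {i..<j} \<bullet> P j (sum z {i..<j}) = sum z {i..<j} \<bullet> sum z {i..<j}"
      unfolding inner_sum_left[of z "{i..<j}"] using that V by (intro sum.cong) (simp_all add: z_P)
    show "sum z {j..<e} \<bullet> P j (sum z {i..<j}) = 0"
      unfolding inner_sum_left[of z "{j..<e}"] using that V by (intro sum.neutral) (simp add: z_P)
  qed
  have halved: "(norm (sum z {l..<l + N}))\<^sup>2 \<le> (1 + q) ^ m * (\<Sum>k = l..<l + N. (norm (z k))\<^sup>2)"
    using norm_sum_le_by_halving[of q l "l + N" z l N m] angle q N by auto

  have norm_z: "norm (z k) \<le> 2 * K * norm (D k v)" for k
  proof -
    have "norm (z k) * norm (z k) = D k (z k) \<bullet> D k v"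
      using z[OF z_V] by (metis power2_norm_eq_inner power2_eq_square)
    also have "\<dots> \<le> norm (D k (z k)) * norm (D k v)"
      by (rule norm_cauchy_schwarz)
    also have "\<dots> \<le> (2 * K * norm (z k)) * norm (D k v)"
      by (intro mult_right_mono bound_D) simp
    finally have "norm (z k) * norm (z k) \<le> (2 * K * norm (D k v)) * norm (z k)"
      by (simp add: mult_ac)
    then show ?thesis
      using K by (cases "z k = 0") auto
  qed

  define S where "S = (\<Sum>k = l..<l + N. (norm (D k v))\<^sup>2)"
  have "(\<Sum>k = l..<l + N. (norm (z k))\<^sup>2) \<le> (\<Sum>k = l..<l + N. (2 * K * norm (D k v))\<^sup>2)"
    using norm_z by (intro sum_mono power_mono) auto
  also have "\<dots> = 4 * K\<^sup>2 * S"
    by (simp add: S_def sum_distrib_left power_mult_distrib)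
  finally have "(norm (sum z {l..<l + N}))\<^sup>2 \<le> (1 + q) ^ m * (4 * K\<^sup>2 * S)"
    using halved q by (meson mult_left_mono order_trans zero_le_power add_nonneg_nonneg zero_le_one)
  then have Z: "(norm v)\<^sup>2 * (norm (sum z {l..<l + N}))\<^sup>2 \<le> (norm v)\<^sup>2 * ((1 + q) ^ m * (4 * K\<^sup>2 * S))"
    by (intro mult_left_mono) auto
  have v: "v \<in> V"
    unfolding V_def by (simp add: span_base)
  have "S = sum z {l..<l + N} \<bullet> v"
    unfolding S_def inner_sum_left by (intro sum.cong) (simp_all add: z[OF v] power2_norm_eq_inner)
  also have "\<dots> \<le> norm (sum z {l..<l + N}) * norm v"
    by (rule norm_cauchy_schwarz)
  finally have S_le: "S \<le> norm (sum z {l..<l + N}) * norm v" .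
  have S: "S \<ge> 0"
    unfolding S_def by (intro sum_nonneg) simp
  have "S * S \<le> (norm v)\<^sup>2 * (norm (sum z {l..<l + N}))\<^sup>2"
    using power_mono[OF S_le S, of 2] by (simp add: power_mult_distrib power2_eq_square mult_ac)
  with Z have "S * S \<le> (4 * K\<^sup>2 * (1 + q) ^ m * (norm v)\<^sup>2) * S"
    by (simp add: mult_ac)
  then have "S \<le> 4 * K\<^sup>2 * (1 + q) ^ m * (norm v)\<^sup>2"
    using S q by (cases "S = 0") auto
  then show ?thesis
    by (simp add: S_def D_def q_def)
qed

section \<open>Galerkin projections\<close>

context nested_galerkin
begin

lemma inf_sup_bound:
  assumes x: "x \<in> X l" and M: "\<And>y. y \<in> Y l \<Longrightarrow> \<bar>a x y\<bar> \<le> M * norm y" "M \<ge> 0"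
  shows "\<gamma> * norm x \<le> M"
proof (cases "x = 0")
  case False
  have "ereal \<gamma> \<le> inf_sup a (X l) (Y l)"
    by (rule discrete_inf_sup)
  also have "\<dots> \<le> (SUP y \<in> Y l - {0}. ereal (\<bar>a x y\<bar> / (norm x * norm y)))"
    unfolding inf_sup_def using x False by (intro INF_lower) auto
  also have "\<dots> \<le> ereal (M / norm x)"
  proof (rule SUP_least)
    fix y assume y: "y \<in> Y l - {0}"
    then have "\<bar>a x y\<bar> / (norm x * norm y) \<le> (M * norm y) / (norm x * norm y)"
      using M(1) by (intro divide_right_mono) auto
    then show "ereal (\<bar>a x y\<bar> / (norm x * norm y)) \<le> ereal (M / norm x)"
      using y by simp
  qed
  finally show ?thesis
    using False by (simp add: field_simps)
qed (use M in simp)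

lemma trial_eq_0:
  assumes "x \<in> X l" "\<And>y. y \<in> Y l \<Longrightarrow> a x y = 0"
  shows "x = 0"
proof -
  have "\<gamma> * norm x \<le> 0"
    using assms by (intro inf_sup_bound[of x l]) auto
  then show ?thesis
    using gamma_pos by (simp add: mult_le_0_iff)
qed

lemma galerkin_unique:
  assumes "z \<in> X l" "z' \<in> X l" "\<And>y. y \<in> Y l \<Longrightarrow> a z y = a z' y"
  shows "z = z'"
  using trial_eq_0[of "z - z'" l] assms subspace_diff[OF subspace_X[of l]]
  by (simp add: bilinear_lsub[OF bilinear])

lemma galerkin_exists: "\<exists>z\<in>X l. \<forall>y\<in>Y l. a z y = a x y"
proof -
  obtain B where B: "finite B" "Y l = span B"
    using finite_dim_Y by blast
  obtain C where C: "finite C" "span C = span B" "pairwise orthogonal C"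
    using basis_orthogonal[OF B(1)] by blast
  \<comment> \<open>\<open>R w\<close> represents \<open>a w\<close> in \<open>Y l\<close>. The explicit formula shows that it is linear in \<open>w\<close>.\<close>
  define R where "R = (\<lambda>w. \<Sum>c\<in>C. (a w c / (c \<bullet> c)) *\<^sub>R c)"
  have lin_a: "linear (a w)" for w
    using bilinear by (simp add: bilinear_def)
  have R: "R w \<bullet> y = a w y" if "y \<in> Y l" for w y
    unfolding R_def using that B C by (intro span_orthogonal_represents lin_a) auto
  have lin_R: "linear R"
    unfolding R_def
    by (intro linearI)
      (simp_all add: bilinear_ladd[OF bilinear] bilinear_lmul[OF bilinear] add_divide_distrib
        scaleR_add_left sum.distrib scaleR_sum_right)
  have R_Y: "R w \<in> Y l" for w
    unfolding R_def B(2) C(2)[symmetric] by (intro span_sum span_scale span_base)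
  have "inj_on R (X l)"
    by (intro inj_onI galerkin_unique) (auto simp flip: R)
  then have "Y l \<subseteq> R ` X l"
    using B R_Y by (intro linear_inj_on_equal_dim_surj lin_R subspace_X dim_eq) auto
  then obtain z where "z \<in> X l" "R z = R x"
    using R_Y by (metis imageE subsetD)
  then show ?thesis
    using R by metis
qed

abbreviation G :: "nat \<Rightarrow> 'x \<Rightarrow> 'x" where
  "G l \<equiv> galerkin_proj a (X l) (Y l)"

lemma galerkin_mem: "G l x \<in> X l"
  and galerkin_eq: "y \<in> Y l \<Longrightarrow> a (G l x) y = a x y"
proof -
  have "\<exists>!z. z \<in> X l \<and> (\<forall>y\<in>Y l. a z y = a x y)"
    using galerkin_exists[of l x] galerkin_unique by (metis (no_types, lifting))
  from theI'[OF this] show "G l x \<in> X l" "y \<in> Y l \<Longrightarrow> a (G l x) y = a x y"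
    unfolding galerkin_proj_def by auto
qed

lemma galerkin_eqI:
  assumes "z \<in> X l" "\<And>y. y \<in> Y l \<Longrightarrow> a z y = a x y"
  shows "G l x = z"
  using assms by (intro galerkin_unique[of _ l] galerkin_mem) (simp_all add: galerkin_eq)

lemma linear_galerkin: "linear (G l)"
  by (intro linearI galerkin_eqI subspace_add subspace_scale subspace_X galerkin_mem)
    (simp_all add: bilinear_ladd[OF bilinear] bilinear_lmul[OF bilinear] galerkin_eq)

lemma galerkin_comp: "G j (G k x) = G (min j k) x"
proof (cases "j \<le> k")
  case True
  then have "Y j \<subseteq> Y k"
    using lift_Suc_mono_le[of Y] nested_Y by blast
  then have "G j (G k x) = G j x"
    by (intro galerkin_eqI galerkin_mem) (auto simp: galerkin_eq)
  then show ?thesis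
    using True by (simp add: min_absorb1)
next
  case False
  then have "X k \<subseteq> X j"
    using lift_Suc_mono_le[of X] nested_X by (meson nat_le_linear)
  then have "G j (G k x) = G k x"
    using galerkin_mem by (intro galerkin_eqI) auto
  then show ?thesis
    using False by (simp add: min_absorb2)
qed

lemma norm_galerkin_le:
  assumes "C\<^sub>a \<le> C" "0 \<le> C" "0 < g" "g \<le> \<gamma>"
  shows "norm (G l x) \<le> C / g * norm x"
proof -
  have "g * norm (G l x) \<le> \<gamma> * norm (G l x)"
    using assms by (intro mult_right_mono) auto
  also have "\<dots> \<le> C * norm x"
  proof (rule inf_sup_bound[OF galerkin_mem])
    fix y assume "y \<in> Y l"
    then have "\<bar>a (G l x) y\<bar> \<le> C\<^sub>a * (norm x * norm y)"
      using continuity[of x y] by (simp add: galerkin_eq mult_ac)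
    also have "\<dots> \<le> C * (norm x * norm y)"
      using assms by (intro mult_right_mono) auto
    finally show "\<bar>a (G l x) y\<bar> \<le> C * norm x * norm y"
      by (simp add: mult_ac)
  qed (use assms in simp)
  finally show ?thesis
    using assms by (simp add: field_simps)
qed

text \<open>
  For a zero trial space the inf-sup condition is vacuous. A nonzero one forces \<open>K\<^sub>0 \<ge> 1\<close>, so that
  \<open>1 - 1/K\<^sub>0\<^sup>2\<close> is nonnegative and its root is the bound for a cosine.
\<close>

lemma inf_sup_le_continuity:
  assumes "X l \<noteq> {0}"
  shows "\<gamma> \<le> C\<^sub>a"
proof -
  obtain x where x: "x \<in> X l" "x \<noteq> 0"
    using assms subspace_0[OF subspace_X[of l]] by blast
  then obtain y where y: "a x y \<noteq> 0"
    using trial_eq_0 by blast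
  then have "y \<noteq> 0"
    using bilinear_rzero[OF bilinear] by auto
  \<comment> \<open>The form is nonzero, so its continuity constant is positive.\<close>
  have "0 < C\<^sub>a * (norm x * norm y)"
    using continuity[of x y] y by (simp add: mult_ac)
  with x(2) \<open>y \<noteq> 0\<close> have "C\<^sub>a \<ge> 0"
    using zero_less_mult_pos2[of C\<^sub>a "norm x * norm y"] by simp
  then have "\<gamma> * norm x \<le> C\<^sub>a * norm x"
    using x(1) continuity by (intro inf_sup_bound) auto
  with x(2) show ?thesis
    by simp
qed

end

section \<open>The quasi-orthogonality estimate\<close>

lemma sigma_qo_bounds:
  assumes "K \<ge> 1"
  shows "0 \<le> sigma_qo K" "sigma_qo K < 1" "2 powr sigma_qo K = 1 + sqrt (1 - 1 / K\<^sup>2)"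
proof -
  have eq: "K powi (- 2) = 1 / K\<^sup>2"
    by (simp add: power_int_minus field_simps)
  have "0 < 1 / K\<^sup>2" "1 / K\<^sup>2 \<le> 1"
    using assms by (auto simp: divide_le_eq_1 one_le_power)
  moreover define q where "q = sqrt (1 - 1 / K\<^sup>2)"
  ultimately have "0 \<le> q" "q < 1"
    by auto
  then show "0 \<le> sigma_qo K" "sigma_qo K < 1" "2 powr sigma_qo K = 1 + sqrt (1 - 1 / K\<^sup>2)"
    unfolding sigma_qo_def eq q_def[symmetric] by (auto simp: log_less_iff)
qed

lemma ex_power_of_2_between:
  assumes "N \<ge> 1"
  obtains m where "N \<le> 2 ^ m" "2 ^ m \<le> 2 * (N::nat)"
proof (cases "N = 1")
  case True
  then show ?thesis using that[of 0] by simp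
next
  case False
  then obtain n where "2 ^ n < N" "N \<le> 2 ^ (n + 1)"
    using ex_power_ivl2[of 2 N] assms by auto
  then show ?thesis using that[of "n + 1"] by simp
qed

theorem corollary3p5:
  fixes C\<^sub>0 \<gamma>\<^sub>0 C\<^sub>a \<gamma> :: real
    and a :: "'x::{real_inner,complete_space} \<Rightarrow> 'y::{real_inner,complete_space} \<Rightarrow> real"
    and X :: "nat \<Rightarrow> 'x set" and Y :: "nat \<Rightarrow> 'y set"
  defines "K\<^sub>0 \<equiv> C\<^sub>0 / \<gamma>\<^sub>0"
  assumes "C\<^sub>0 > 0" and "\<gamma>\<^sub>0 > 0"
    and "nested_galerkin a X Y C\<^sub>a \<gamma>"
    and "\<exists>l. X l \<noteq> {0}"
    and "C\<^sub>a \<le> C\<^sub>0" and "\<gamma> \<ge> \<gamma>\<^sub>0"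
  shows "sigma_qo K\<^sub>0 < 1 \<and>
    (\<forall>u l N. N \<ge> 1 \<longrightarrow>
      (\<Sum>k = l..<l + N.
          (norm (galerkin_proj a (X (Suc k)) (Y (Suc k)) u - galerkin_proj a (X k) (Y k) u))\<^sup>2)
      \<le> C_qo K\<^sub>0 * real N powr sigma_qo K\<^sub>0 * (norm (u - galerkin_proj a (X l) (Y l) u))\<^sup>2)"
proof -
  interpret nested_galerkin a X Y C\<^sub>a \<gamma> by fact
  have "\<gamma>\<^sub>0 \<le> C\<^sub>0"
    using \<open>\<exists>l. X l \<noteq> {0}\<close> \<open>C\<^sub>a \<le> C\<^sub>0\<close> \<open>\<gamma> \<ge> \<gamma>\<^sub>0\<close> inf_sup_le_continuity by fastforce
  then have K: "K\<^sub>0 \<ge> 1"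
    using \<open>\<gamma>\<^sub>0 > 0\<close> by (simp add: K\<^sub>0_def)
  note \<sigma> = sigma_qo_bounds[OF K]
  have "(\<Sum>k = l..<l + N. (norm (G (Suc k) u - G k u))\<^sup>2)
      \<le> C_qo K\<^sub>0 * real N powr sigma_qo K\<^sub>0 * (norm (u - G l u))\<^sup>2" if N: "N \<ge> 1" for u l N
  proof -
    obtain m where m: "N \<le> 2 ^ m" "2 ^ m \<le> 2 * N"
      using ex_power_of_2_between[OF N] .
    define v where "v = u - G l u"
    have increment: "G (Suc k) v - G k v = G (Suc k) u - G k u" if "k \<ge> l" for k
      using that by (simp add: v_def linear_diff[OF linear_galerkin] galerkin_comp min_absorb2)
    have rank: "\<exists>B. finite B \<and> range (G k) \<subseteq> span B" for k
      using finite_dim_X[of k] galerkin_mem by (metis image_subsetI)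
    have bound: "norm (G k x) \<le> K\<^sub>0 * norm x" for k x
      unfolding K\<^sub>0_def using assms by (intro norm_galerkin_le) auto
    have "(1 + sqrt (1 - 1 / K\<^sub>0\<^sup>2)) ^ m = (2 powr sigma_qo K\<^sub>0) powr real m"
      by (simp add: \<sigma>(3)[symmetric] powr_realpow)
    also have "\<dots> = real (2 ^ m) powr sigma_qo K\<^sub>0"
      by (simp add: powr_powr powr_realpow[symmetric] mult.commute)
    also have "\<dots> \<le> real (2 * N) powr sigma_qo K\<^sub>0"
      using m(2) \<sigma>(1) by (intro powr_mono2) (simp_all only: of_nat_le_iff of_nat_0_le_iff)
    also have "\<dots> = (1 + sqrt (1 - 1 / K\<^sub>0\<^sup>2)) * real N powr sigma_qo K\<^sub>0"
      by (simp add: powr_mult \<sigma>(3))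
    finally have factor:
      "(1 + sqrt (1 - 1 / K\<^sub>0\<^sup>2)) ^ m \<le> (1 + sqrt (1 - 1 / K\<^sub>0\<^sup>2)) * real N powr sigma_qo K\<^sub>0" .
    have "(\<Sum>k = l..<l + N. (norm (G (Suc k) u - G k u))\<^sup>2)
        = (\<Sum>k = l..<l + N. (norm (G (Suc k) v - G k v))\<^sup>2)"
      by (intro sum.cong) (simp_all add: increment)
    also have "\<dots> \<le> 4 * K\<^sub>0\<^sup>2 * (1 + sqrt (1 - 1 / K\<^sub>0\<^sup>2)) ^ m * (norm v)\<^sup>2"
      by (intro projection_chain_square_sum linear_galerkin galerkin_comp bound rank K m(1))
    also have "\<dots> \<le> 4 * K\<^sub>0\<^sup>2 * ((1 + sqrt (1 - 1 / K\<^sub>0\<^sup>2)) * real N powr sigma_qo K\<^sub>0) * (norm v)\<^sup>2"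
      using factor by (intro mult_right_mono mult_left_mono) auto
    also have "\<dots> = C_qo K\<^sub>0 * real N powr sigma_qo K\<^sub>0 * (norm v)\<^sup>2"
      by (simp add: C_qo_def power_int_minus inverse_eq_divide)
    finally show ?thesis
      by (simp add: v_def)
  qed
  with \<sigma>(2) show ?thesis
    by blast
qed

end
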